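(* Let $\delta\in(0,1)$ and $t_n=n^{\delta/2}$. For each $n$ let $\theta_0=\theta_0^{(n)}\in\mathbb{R}^n$ with $\|\theta_0\|_2=o(\sqrt n)$ as $n\to\infty$. Let $\theta\in\mathbb{R}^n$ have the prior $$\theta_j\mid\tau\ \overset{\text{ind.}}{\sim}\ \mathrm{N}(0,\tau),\quad j=1,\dots,n,\qquad \tau\sim g,$$ where the density $g$ on $(0,\infty)$ belongs to the class $\mathcal{G}$ with constant $M$. Then there are constants $C_1,C_2>0$ depending only on $M$, and constants $c_1,c_2>0$ with $c_1$ depending on $M$ and $\delta$, such that for all sufficiently large $n$: $$C_1e^{-(1-\delta)\log n}\le \mathbb{P}(\|\theta\|_2<t_n)\le C_2e^{-(1-\delta)\log n};$$ and furthermore, if $\tfrac14\|\theta_0\|_2>t_n$, then $$e^{-c_1 n\log a_n}\le \mathbb{P}(\|\theta-\theta_0\|_2<t_n)\le e^{-c_2 n\log a_n},$$ where $a_n=\|\theta_0\|_2/(\sqrt2\,t_n)>1$.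
   Context: $\|\cdot\|_2$ is the Euclidean norm; $\mathrm{N}(0,\tau)$ is the normal distribution with mean $0$ and variance $\tau$. The class $\mathcal{G}$ (with constant $M>0$) consists of probability densities $g$ on $(0,\infty)$ satisfying (i) $g(\tau)\le M$ for all $\tau\in(0,\infty)$ and (ii) $g(\tau)>1/M$ for all $\tau\in(0,1)$. Probabilities are with respect to the marginal prior distribution of $\theta$ (with $\tau$ integrated out); $g$ does not depend on $n$. *)

theory Defs
  imports "HOL-Probability.Probability" "HOL-Library.Landau_Symbols"
begin

text \<open>
  Only the values of \<open>g\<close> on the open half-line \<open>(0, \<infinity>)\<close> matter, both in the law of \<open>\<tau>\<close> and in the
  density class: the base measure is Lebesgue measure restricted to \<open>{0<..}\<close>.
\<close>

definition variance_law :: "(real \<Rightarrow> real) \<Rightarrow> real measure" where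
  "variance_law g = density (restrict_space lborel {0<..}) (\<lambda>\<tau>. ennreal (g \<tau>))"

definition density_class :: "real \<Rightarrow> (real \<Rightarrow> real) set" where
  "density_class M = {g.
     g \<in> borel_measurable (restrict_space lborel {0<..}) \<and>
     (\<forall>\<tau>>0. 0 \<le> g \<tau>) \<and>
     prob_space (variance_law g) \<and>
     (\<forall>\<tau>>0. g \<tau> \<le> M) \<and>
     (\<forall>\<tau>. 0 < \<tau> \<and> \<tau> < 1 \<longrightarrow> g \<tau> > 1 / M)}"

text \<open>
  Since \<open>n\<close> varies, a vector of dimension \<open>n\<close> is a function on the index set \<open>{..<n}\<close>, with
  Euclidean norm \<^term>\<open>\<lambda>x. L2_set x {..<n}\<close>. The library parametrises \<^const>\<open>normal_density\<close> by
  the standard deviation, hence the square root of the variance \<open>\<tau>\<close>.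
\<close>

definition conditional_law :: "nat \<Rightarrow> real \<Rightarrow> (nat \<Rightarrow> real) measure" where
  "conditional_law n \<tau> =
     (\<Pi>\<^sub>M j\<in>{..<n}. density lborel (\<lambda>x. ennreal (normal_density 0 (sqrt \<tau>) x)))"

text \<open>The marginal law of \<open>\<theta>\<close>: draw \<open>\<tau>\<close>, then draw \<open>\<theta>\<close> given \<open>\<tau>\<close>.\<close>

definition marginal_prior :: "(real \<Rightarrow> real) \<Rightarrow> nat \<Rightarrow> (nat \<Rightarrow> real) measure" where
  "marginal_prior g n = variance_law g \<bind> conditional_law n"

end

theory Submission
  imports Defs
begin

text \<open>
  Given \<open>\<tau>\<close>, every upper bound is a Chernoff bound: for \<open>k > 0\<close> and \<open>u = 1 + 2k\<tau>\<close>, completing the square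
  gives \<open>P(\<parallel>\<theta> - b\<parallel> < t | \<tau>) \<le> exp(k t\<^sup>2) E exp(-k \<parallel>\<theta> - b\<parallel>\<^sup>2) = exp(k t\<^sup>2) u\<^sup>-\<^sup>n\<^sup>/\<^sup>2 exp(-k \<parallel>b\<parallel>\<^sup>2 / u)\<close>.
  For \<open>b = 0\<close> the choice \<open>k = 1 / t\<^sup>2\<close> makes this integrable over \<open>\<tau> \<in> (0, \<infinity>)\<close>, with integral
  \<open>e t\<^sup>2 / (n - 2)\<close>. For \<open>b = \<theta>\<^sub>0\<close> the choice \<open>k = n / (2 t\<^sup>2)\<close> bounds it by \<open>(t / \<parallel>b\<parallel>)\<^sup>n\<close> uniformly
  in \<open>\<tau>\<close>, because \<open>w \<le> exp(w - 1)\<close>.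

  The lower bounds keep only the values of \<open>\<tau>\<close> that matter. For \<open>\<tau> < t\<^sup>2 / (4n)\<close> the centred ball has
  conditional probability at least one half, by the Chernoff bound with the negative parameter
  \<open>k = -1 / (4\<tau>)\<close>. For \<open>\<tau>\<close> between \<open>\<parallel>\<theta>\<^sub>0\<parallel>\<^sup>2 / (2n)\<close> and \<open>\<parallel>\<theta>\<^sub>0\<parallel>\<^sup>2 / n\<close> the shifted ball contains a cube
  of half-width \<open>t / \<surd>n\<close>, on which the Gaussian density is bounded below coordinatewise. All the
  exponential factors lost in this way are powers of \<open>a\<^sub>n\<close>, since \<open>a\<^sub>n > 2\<surd>2 > e\<close>.
\<close>

section \<open>Shifted balls, and the conditional law as a probability kernel\<close>

abbreviation centered_normal :: "real \<Rightarrow> real measure" where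
  "centered_normal \<tau> \<equiv> density lborel (\<lambda>x. ennreal (normal_density 0 (sqrt \<tau>) x))"

text \<open>Carved out of the space of the Borel product, so that one and the same set is an event
  for every conditional law and for the marginal prior.\<close>

definition shifted_ball :: "nat \<Rightarrow> (nat \<Rightarrow> real) \<Rightarrow> real \<Rightarrow> (nat \<Rightarrow> real) set" where
  "shifted_ball n b t =
     {x \<in> space (\<Pi>\<^sub>M j\<in>{..<n}. borel). L2_set (\<lambda>j. x j - b j) {..<n} < t}"

lemma shifted_ball_sets [measurable]: "shifted_ball n b t \<in> sets (\<Pi>\<^sub>M j\<in>{..<n}. borel)"
  unfolding shifted_ball_def L2_set_def by measurable

lemma sets_conditional_law: "sets (conditional_law n \<tau>) = sets (\<Pi>\<^sub>M j\<in>{..<n}. borel)"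
  unfolding conditional_law_def by (rule sets_PiM_cong) auto

lemma space_conditional_law: "space (conditional_law n \<tau>) = space (\<Pi>\<^sub>M j\<in>{..<n}. borel)"
  by (rule sets_eq_imp_space_eq[OF sets_conditional_law])

lemma prob_space_centered_normal: "\<tau> > 0 \<Longrightarrow> prob_space (centered_normal \<tau>)"
  by (rule prob_space_normal_density) simp

lemma product_prob_space_centered_normal:
  "\<tau> > 0 \<Longrightarrow> product_prob_space (\<lambda>_. centered_normal \<tau>)"
  by (intro product_prob_spaceI prob_space_centered_normal)

lemma prob_space_conditional_law: "\<tau> > 0 \<Longrightarrow> prob_space (conditional_law n \<tau>)"
  unfolding conditional_law_def by (intro prob_space_PiM prob_space_centered_normal)

lemma emeasure_conditional_law_PiE:
  assumes "\<tau> > 0" "\<And>j. j < n \<Longrightarrow> A j \<in> sets borel"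
  shows "emeasure (conditional_law n \<tau>) (Pi\<^sub>E {..<n} A) = (\<Prod>j<n. emeasure (centered_normal \<tau>) (A j))"
proof -
  interpret product_prob_space "\<lambda>_. centered_normal \<tau>"
    using assms(1) by (rule product_prob_space_centered_normal)
  show ?thesis
    unfolding conditional_law_def using assms(2) by (intro emeasure_PiM) auto
qed

text \<open>Boxes form an intersection-stable generator, so measurability in \<open>\<tau>\<close>
  need only be checked on them, where the measure is a finite product of one-dimensional integrals.
  Restricting to positive \<open>\<tau>\<close> matters: at \<open>\<tau> = 0\<close> the formula
  for \<open>normal_density\<close> is identically 0 and describes no probability law.\<close>

lemma measurable_conditional_law:
  "conditional_law n \<in> restrict_space lborel {0<..} \<rightarrow>\<^sub>M subprob_algebra (\<Pi>\<^sub>M j\<in>{..<n}. borel)"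
proof (rule measurable_prob_algebraD,
    rule measurable_prob_algebra_generated[OF sets_PiM Int_stable_prod_algebra prod_algebra_sets_into_space])
  fix \<tau> assume "\<tau> \<in> space (restrict_space lborel {0::real<..})"
  then show "prob_space (conditional_law n \<tau>)"
    by (simp add: prob_space_conditional_law space_restrict_space)
next
  fix \<tau> show "sets (conditional_law n \<tau>) = sets (\<Pi>\<^sub>M j\<in>{..<n}. borel)"
    by (rule sets_conditional_law)
next
  fix A assume "A \<in> prod_algebra {..<n} (\<lambda>_. borel :: real measure)"
  then obtain E where E: "A = Pi\<^sub>E {..<n} E" "\<And>j. j < n \<Longrightarrow> E j \<in> sets borel"
    by (auto simp: prod_algebra_eq_finite Pi_iff)
  have "(\<lambda>\<tau>. \<Prod>j<n. emeasure (centered_normal \<tau>) (E j))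
      \<in> borel_measurable (restrict_space lborel {0<..})"
  proof (rule borel_measurable_prod_ennreal)
    fix j assume "j \<in> {..<n}"
    then have [measurable]: "E j \<in> sets borel" using E by simp
    have "(\<lambda>\<tau>. \<integral>\<^sup>+x. ennreal (normal_density 0 (sqrt \<tau>) x) * indicator (E j) x \<partial>lborel)
        \<in> borel_measurable borel"
      unfolding normal_density_def by measurable
    then have "(\<lambda>\<tau>. emeasure (centered_normal \<tau>) (E j)) \<in> borel_measurable borel"
      by (subst emeasure_density) auto
    then show "(\<lambda>\<tau>. emeasure (centered_normal \<tau>) (E j))
        \<in> borel_measurable (restrict_space lborel {0<..})"
      by (intro measurable_restrict_space1) simp
  qed
  then show "(\<lambda>\<tau>. emeasure (conditional_law n \<tau>) A) \<in> borel_measurable (restrict_space lborel {0<..})"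
    by (rule measurable_cong[THEN iffD1, rotated])
       (simp add: E emeasure_conditional_law_PiE space_restrict_space)
qed

section \<open>Marginal probabilities as integrals over the variance\<close>

lemma measurable_conditional_law_variance_law:
  "conditional_law n \<in> variance_law g \<rightarrow>\<^sub>M subprob_algebra (\<Pi>\<^sub>M j\<in>{..<n}. borel)"
  unfolding variance_law_def using measurable_conditional_law by simp

lemma space_variance_law: "space (variance_law g) = {0<..}"
  by (simp add: variance_law_def space_restrict_space)

lemma space_marginal_prior: "space (marginal_prior g n) = space (\<Pi>\<^sub>M j\<in>{..<n}. borel)"
  unfolding marginal_prior_def
  by (rule space_bind_measurable[OF measurable_conditional_law_variance_law])
     (simp add: space_variance_law)

lemma prob_space_marginal_prior:
  assumes "g \<in> density_class M"
  shows "prob_space (marginal_prior g n)"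
proof -
  have g: "prob_space (variance_law g)" using assms by (simp add: density_class_def)
  show ?thesis
    unfolding marginal_prior_def
    by (rule prob_space.prob_space_bind[OF g _ measurable_conditional_law_variance_law])
       (auto simp: space_variance_law prob_space_conditional_law)
qed

lemma emeasure_marginal_prior:
  assumes "A \<in> sets (\<Pi>\<^sub>M j\<in>{..<n}. borel)"
  shows "emeasure (marginal_prior g n) A =
    (\<integral>\<^sup>+\<tau>. emeasure (conditional_law n \<tau>) A \<partial>variance_law g)"
  unfolding marginal_prior_def
  by (rule emeasure_bind[OF _ measurable_conditional_law_variance_law assms])
     (simp add: space_variance_law)

lemma emeasure_marginal_prior_lborel:
  assumes g: "g \<in> density_class M" and A: "A \<in> sets (\<Pi>\<^sub>M j\<in>{..<n}. borel)"
  shows "emeasure (marginal_prior g n) A =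
    (\<integral>\<^sup>+\<tau>. ennreal (g \<tau>) * emeasure (conditional_law n \<tau>) A * indicator {0<..} \<tau> \<partial>lborel)"
proof -
  have [measurable]: "g \<in> borel_measurable (restrict_space lborel {0<..})"
    using g by (simp add: density_class_def)
  have [measurable]: "(\<lambda>\<tau>. emeasure (conditional_law n \<tau>) A) \<in> borel_measurable (restrict_space lborel {0<..})"
    using measurable_emeasure_kernel[OF measurable_conditional_law A] .
  have "emeasure (marginal_prior g n) A
      = (\<integral>\<^sup>+\<tau>. ennreal (g \<tau>) * emeasure (conditional_law n \<tau>) A \<partial>restrict_space lborel {0<..})"
    unfolding emeasure_marginal_prior[OF A] variance_law_def by (subst nn_integral_density) auto
  also have "\<dots> = (\<integral>\<^sup>+\<tau>. ennreal (g \<tau>) * emeasure (conditional_law n \<tau>) A * indicator {0<..} \<tau> \<partial>lborel)"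
    by (subst nn_integral_restrict_space) auto
  finally show ?thesis .
qed

text \<open>For the shifted ball, where the Chernoff bound is uniform in \<open>\<tau>\<close>:
  averaging against a probability law preserves it.\<close>

lemma emeasure_marginal_prior_le:
  assumes g: "g \<in> density_class M" and A: "A \<in> sets (\<Pi>\<^sub>M j\<in>{..<n}. borel)"
    and le: "\<And>\<tau>. \<tau> > 0 \<Longrightarrow> emeasure (conditional_law n \<tau>) A \<le> c"
  shows "emeasure (marginal_prior g n) A \<le> c"
proof -
  interpret prob_space "variance_law g" using g by (simp add: density_class_def)
  have "emeasure (marginal_prior g n) A \<le> (\<integral>\<^sup>+\<tau>. c \<partial>variance_law g)"
    unfolding emeasure_marginal_prior[OF A]
    by (intro nn_integral_mono le) (simp add: space_variance_law)
  then show ?thesis by (simp add: emeasure_space_1)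
qed

text \<open>Discards all variances outside (\<alpha>, \<beta>). Since \<beta> \<le> 1, the lower
  bound on \<open>g\<close> applies there and gives this interval mass at least (\<beta> -
  \<alpha>)/M.\<close>

lemma emeasure_marginal_prior_ge:
  assumes g: "g \<in> density_class M" and "M > 0" and A: "A \<in> sets (\<Pi>\<^sub>M j\<in>{..<n}. borel)"
    and "0 \<le> \<alpha>" "\<alpha> \<le> \<beta>" "\<beta> \<le> 1" "0 \<le> c"
    and ge: "\<And>\<tau>. \<alpha> < \<tau> \<Longrightarrow> \<tau> < \<beta> \<Longrightarrow> ennreal c \<le> emeasure (conditional_law n \<tau>) A"
  shows "ennreal ((\<beta> - \<alpha>) / M * c) \<le> emeasure (marginal_prior g n) A"
proof -
  have "ennreal ((\<beta> - \<alpha>) / M * c) = ennreal (1 / M * c) * ennreal (\<beta> - \<alpha>)"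
    using assms by (simp add: ennreal_mult'[symmetric] mult.commute)
  also have "\<dots> = (\<integral>\<^sup>+\<tau>. ennreal (1 / M * c) * indicator {\<alpha><..<\<beta>} \<tau> \<partial>lborel)"
    using assms by (subst nn_integral_cmult_indicator) auto
  also have "\<dots> \<le> (\<integral>\<^sup>+\<tau>. ennreal (g \<tau>) * emeasure (conditional_law n \<tau>) A * indicator {0<..} \<tau> \<partial>lborel)"
  proof (intro nn_integral_mono)
    fix \<tau>
    show "ennreal (1 / M * c) * indicator {\<alpha><..<\<beta>} \<tau>
        \<le> ennreal (g \<tau>) * emeasure (conditional_law n \<tau>) A * indicator {0<..} \<tau>"
    proof (cases "\<alpha> < \<tau> \<and> \<tau> < \<beta>")
      case True
      then have "1 / M \<le> g \<tau>" using g assms by (auto simp: density_class_def intro: less_imp_le)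
      then have "ennreal (1 / M) * ennreal c \<le> ennreal (g \<tau>) * emeasure (conditional_law n \<tau>) A"
        using True ge by (intro mult_mono) (auto intro: ennreal_leI)
      then show ?thesis using True assms by (simp add: ennreal_mult'[symmetric])
    qed auto
  qed
  finally show ?thesis unfolding emeasure_marginal_prior_lborel[OF g A] .
qed

section \<open>Gaussian exponential moments and the Chernoff bound\<close>

lemma nn_integral_centered_normal_exp:
  fixes k b \<tau> :: real
  assumes "\<tau> > 0" and u: "1 + 2 * k * \<tau> > 0"
  shows "(\<integral>\<^sup>+x. ennreal (exp (- k * (x - b)\<^sup>2)) \<partial>centered_normal \<tau>)
       = ennreal (1 / sqrt (1 + 2 * k * \<tau>) * exp (- k * b\<^sup>2 / (1 + 2 * k * \<tau>)))"
proof -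
  \<comment> \<open>Multiplying the normal density by \<open>exp (- k * (x - b)\<^sup>2)\<close>
    yields, up to a constant, the normal density with mean \<mu> and variance \<tau>/u. Only u > 0
    is at stake, so k may be negative.\<close>
  define u where "u = 1 + 2 * k * \<tau>"
  define \<mu> where "\<mu> = 2 * k * \<tau> * b / u"
  define \<sigma> where "\<sigma> = sqrt (\<tau> / u)"
  have pos: "u > 0" "\<tau> > 0" "\<sigma> > 0" using assms by (simp_all add: u_def \<sigma>_def)
  have \<sigma>2: "\<sigma>\<^sup>2 = \<tau> / u" using pos by (simp add: \<sigma>_def)
  have expo: "- x\<^sup>2 / (2 * \<tau>) + (- k * (x - b)\<^sup>2) = - k * b\<^sup>2 / u + - (x - \<mu>)\<^sup>2 / (2 * (\<tau> / u))" for x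
  proof -
    have "u * \<mu> = 2 * k * \<tau> * b" using pos by (simp add: \<mu>_def)
    then have k: "2 * k * \<tau> = u - 1" "u * \<mu> = (u - 1) * b" by (simp_all add: u_def)
    \<comment> \<open>Completing the square after clearing the denominators.\<close>
    have "2 * \<tau> * u * (- x\<^sup>2 / (2 * \<tau>) + (- k * (x - b)\<^sup>2)) = - u * x\<^sup>2 - u * (2 * k * \<tau>) * (x - b)\<^sup>2"
      using pos by (simp add: field_simps)
    also have "\<dots> = - (2 * k * \<tau>) * b\<^sup>2 - (u * x - u * \<mu>)\<^sup>2"
      unfolding k by (simp add: power2_eq_square algebra_simps)
    also have "\<dots> = 2 * \<tau> * u * (- k * b\<^sup>2 / u + - (x - \<mu>)\<^sup>2 / (2 * (\<tau> / u)))"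
      using pos by (simp add: power2_eq_square field_simps)
    finally show ?thesis using pos by (metis mult_cancel_left mult_pos_pos less_irrefl zero_less_numeral)
  qed
  have fac: "normal_density 0 (sqrt \<tau>) x * exp (- k * (x - b)\<^sup>2)
      = 1 / sqrt u * exp (- k * b\<^sup>2 / u) * normal_density \<mu> \<sigma> x" for x
  proof -
    have "normal_density 0 (sqrt \<tau>) x * exp (- k * (x - b)\<^sup>2)
        = 1 / sqrt (2 * pi * \<tau>) * exp (- x\<^sup>2 / (2 * \<tau>) + (- k * (x - b)\<^sup>2))"
      using pos unfolding normal_density_def exp_add by simp
    also have "\<dots> = 1 / sqrt (2 * pi * \<tau>) * (exp (- k * b\<^sup>2 / u) * exp (- (x - \<mu>)\<^sup>2 / (2 * \<sigma>\<^sup>2)))"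
      unfolding expo \<sigma>2 exp_add ..
    also have "1 / sqrt (2 * pi * \<tau>) = 1 / sqrt u * (1 / sqrt (2 * pi * \<sigma>\<^sup>2))"
      unfolding \<sigma>2 using pos by (simp add: real_sqrt_mult real_sqrt_divide)
    finally show ?thesis by (simp add: normal_density_def)
  qed
  have "(\<integral>\<^sup>+x. ennreal (exp (- k * (x - b)\<^sup>2)) \<partial>centered_normal \<tau>)
      = (\<integral>\<^sup>+x. ennreal (normal_density 0 (sqrt \<tau>) x * exp (- k * (x - b)\<^sup>2)) \<partial>lborel)"
    by (subst nn_integral_density) (auto simp: ennreal_mult')
  also have "\<dots> = (\<integral>\<^sup>+x. ennreal (1 / sqrt u * exp (- k * b\<^sup>2 / u)) * ennreal (normal_density \<mu> \<sigma> x) \<partial>lborel)"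
    unfolding fac by (simp only: ennreal_mult''[OF normal_density_nonneg])
  also have "\<dots> = ennreal (1 / sqrt u * exp (- k * b\<^sup>2 / u)) * (\<integral>\<^sup>+x. ennreal (normal_density \<mu> \<sigma> x) \<partial>lborel)"
    by (rule nn_integral_cmult) simp
  also have "(\<integral>\<^sup>+x. ennreal (normal_density \<mu> \<sigma> x) \<partial>lborel) = 1"
    using pos by (subst nn_integral_eq_integral) auto
  finally show ?thesis by (simp add: u_def)
qed

text \<open>The exponential of a sum of squares factorises over the independent coordinates.\<close>

lemma nn_integral_conditional_law_exp:
  fixes k \<tau> :: real
  assumes "\<tau> > 0" and u: "1 + 2 * k * \<tau> > 0"
  shows "(\<integral>\<^sup>+x. ennreal (exp (- k * (L2_set (\<lambda>j. x j - b j) {..<n})\<^sup>2)) \<partial>conditional_law n \<tau>)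
       = ennreal ((1 / sqrt (1 + 2 * k * \<tau>)) ^ n * exp (- k * (L2_set b {..<n})\<^sup>2 / (1 + 2 * k * \<tau>)))"
proof -
  interpret product_prob_space "\<lambda>_. centered_normal \<tau>"
    using assms(1) by (rule product_prob_space_centered_normal)
  have L2: "(L2_set f {..<n})\<^sup>2 = (\<Sum>j<n. (f j)\<^sup>2)" for f
    by (simp add: L2_set_def sum_nonneg)
  have "(\<integral>\<^sup>+x. ennreal (exp (- k * (L2_set (\<lambda>j. x j - b j) {..<n})\<^sup>2)) \<partial>conditional_law n \<tau>)
      = (\<integral>\<^sup>+x. (\<Prod>j<n. ennreal (exp (- k * (x j - b j)\<^sup>2))) \<partial>conditional_law n \<tau>)"
    unfolding L2 by (intro nn_integral_cong) (simp add: sum_distrib_left exp_sum prod_ennreal flip: sum_negf)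
  also have "\<dots> = (\<Prod>j<n. \<integral>\<^sup>+x. ennreal (exp (- k * (x - b j)\<^sup>2)) \<partial>centered_normal \<tau>)"
    unfolding conditional_law_def by (rule product_nn_integral_prod) auto
  also have "\<dots> = (\<Prod>j<n. ennreal (1 / sqrt (1 + 2 * k * \<tau>) * exp (- k * (b j)\<^sup>2 / (1 + 2 * k * \<tau>))))"
    by (simp only: nn_integral_centered_normal_exp[OF assms])
  also have "\<dots> = ennreal (\<Prod>j<n. 1 / sqrt (1 + 2 * k * \<tau>) * exp (- k * (b j)\<^sup>2 / (1 + 2 * k * \<tau>)))"
    using u by (intro prod_ennreal) auto
  also have "(\<Prod>j<n. 1 / sqrt (1 + 2 * k * \<tau>) * exp (- k * (b j)\<^sup>2 / (1 + 2 * k * \<tau>)))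
      = (1 / sqrt (1 + 2 * k * \<tau>)) ^ n * exp (\<Sum>j<n. - k * (b j)\<^sup>2 / (1 + 2 * k * \<tau>))"
    unfolding prod.distrib by (simp add: exp_sum)
  also have "(\<Sum>j<n. - k * (b j)\<^sup>2 / (1 + 2 * k * \<tau>)) = - k * (L2_set b {..<n})\<^sup>2 / (1 + 2 * k * \<tau>)"
    unfolding L2 sum_divide_distrib sum_distrib_left ..
  finally show ?thesis .
qed

lemma L2_set_less_imp_power2_le:
  "0 \<le> t \<Longrightarrow> L2_set f A < t \<Longrightarrow> (L2_set f A)\<^sup>2 \<le> t\<^sup>2"
  by (intro power_mono) auto

text \<open>Markov's inequality for the exponential. The factor k stays on both sides of the last
  hypothesis so that k > 0 covers balls and k < 0 covers their complements.\<close>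

lemma emeasure_conditional_law_le_exp:
  fixes k \<tau> t :: real
  assumes "\<tau> > 0" and "1 + 2 * k * \<tau> > 0"
    and A: "A \<in> sets (\<Pi>\<^sub>M j\<in>{..<n}. borel)"
    and le: "\<And>x. x \<in> A \<Longrightarrow> k * (L2_set (\<lambda>j. x j - b j) {..<n})\<^sup>2 \<le> k * t\<^sup>2"
  shows "emeasure (conditional_law n \<tau>) A
    \<le> ennreal (exp (k * t\<^sup>2) * ((1 / sqrt (1 + 2 * k * \<tau>)) ^ n
         * exp (- k * (L2_set b {..<n})\<^sup>2 / (1 + 2 * k * \<tau>))))"
proof -
  let ?e = "\<lambda>x. exp (- k * (L2_set (\<lambda>j. x j - b j) {..<n})\<^sup>2)"
  have meas: "(\<lambda>x. ennreal (?e x)) \<in> borel_measurable (conditional_law n \<tau>)"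
    unfolding L2_set_def measurable_cong_sets[OF sets_conditional_law refl] by measurable
  have "emeasure (conditional_law n \<tau>) A = (\<integral>\<^sup>+x. indicator A x \<partial>conditional_law n \<tau>)"
    using A by (simp add: sets_conditional_law)
  also have "\<dots> \<le> (\<integral>\<^sup>+x. ennreal (exp (k * t\<^sup>2)) * ennreal (?e x) \<partial>conditional_law n \<tau>)"
  proof (intro nn_integral_mono)
    fix x
    show "indicator A x \<le> ennreal (exp (k * t\<^sup>2)) * ennreal (?e x)"
    proof (cases "x \<in> A")
      case True
      then have "1 \<le> exp (k * t\<^sup>2) * ?e x" using le[OF True] by (simp flip: exp_add)
      then show ?thesis using True by (simp flip: ennreal_mult)
    qed auto
  qed
  also have "\<dots> = ennreal (exp (k * t\<^sup>2)) * (\<integral>\<^sup>+x. ennreal (?e x) \<partial>conditional_law n \<tau>)"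
    by (rule nn_integral_cmult[OF meas])
  finally show ?thesis
    unfolding nn_integral_conditional_law_exp[OF assms(1,2)] using assms(2)
    by (simp add: ennreal_mult')
qed

section \<open>Centred balls\<close>

lemma nn_integral_rational_decay:
  fixes s :: real and n :: nat
  assumes "s > 0" "n \<ge> 3"
  shows "(\<integral>\<^sup>+\<tau>. ennreal ((1 / sqrt (1 + 2 * \<tau> / s)) ^ n) * indicator {0..} \<tau> \<partial>lborel)
    = ennreal (s / (real n - 2))"
proof -
  \<comment> \<open>An antiderivative of the integrand that tends to 0 at infinity: n \<ge> 3 makes
    the exponent 1 - n/2 negative.\<close>
  define F where "F \<tau> = - (s / (real n - 2)) * (1 + 2 * \<tau> / s) powr (1 - real n / 2)" for \<tau>
  have n: "real n > 2" using assms by simp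
  have eq: "(1 / sqrt (1 + 2 * \<tau> / s)) ^ n = (1 + 2 * \<tau> / s) powr (- real n / 2)" if "0 \<le> \<tau>" for \<tau>
  proof -
    have "0 < 1 + 2 * \<tau> / s" using that assms by (simp add: add_pos_nonneg)
    then show ?thesis
      by (simp add: powr_half_sqrt[symmetric] powr_minus powr_realpow[symmetric] powr_powr powr_divide
          field_simps)
  qed
  have "(\<integral>\<^sup>+\<tau>. ennreal ((1 / sqrt (1 + 2 * \<tau> / s)) ^ n) * indicator {0..} \<tau> \<partial>lborel)
      = (\<integral>\<^sup>+\<tau>. ennreal ((1 + 2 * \<tau> / s) powr (- real n / 2)) * indicator {0..} \<tau> \<partial>lborel)"
    by (intro nn_integral_cong) (auto simp: eq split: split_indicator)
  also have "\<dots> = ennreal (0 - F 0)"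
  proof (rule nn_integral_FTC_atLeast)
    fix \<tau> :: real assume "0 \<le> \<tau>"
    then have pos: "0 < 1 + 2 * \<tau> / s" using assms by (simp add: add_pos_nonneg)
    have "- (s / (real n - 2)) * ((1 - real n / 2) * (2 / s)) = 1"
      using n assms by (simp add: field_simps)
    then have fac: "- (s / (real n - 2)) * (((1 - real n / 2) * (2 / s)) * y) = y" for y
      by (metis mult.assoc mult_1)
    have "((\<lambda>\<tau>. 1 + 2 * \<tau> / s) has_real_derivative 2 / s) (at \<tau>)"
      using assms by (auto intro!: derivative_eq_intros)
    then have "(F has_real_derivative - (s / (real n - 2)) *
        ((1 - real n / 2) * (1 + 2 * \<tau> / s) powr (1 - real n / 2 - 1) * (2 / s))) (at \<tau>)"
      unfolding F_def by (intro DERIV_cmult DERIV_chain2[where f = "\<lambda>z. z powr _"]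
          has_real_derivative_powr pos)
    moreover have "1 - real n / 2 - 1 = - real n / 2" by simp
    ultimately have "(F has_real_derivative
        - (s / (real n - 2)) * (((1 - real n / 2) * (2 / s)) * (1 + 2 * \<tau> / s) powr (- real n / 2))) (at \<tau>)"
      by (simp only: mult_ac)
    then show "(F has_real_derivative (1 + 2 * \<tau> / s) powr (- real n / 2)) (at \<tau>)"
      unfolding fac .
  next
    have "filterlim (\<lambda>\<tau>. 1 + 2 * \<tau> / s) at_top at_top"
      using assms by real_asymp
    then have "((\<lambda>\<tau>. (1 + 2 * \<tau> / s) powr (1 - real n / 2)) \<longlongrightarrow> 0) at_top"
      using n by (intro tendsto_neg_powr) auto
    then show "(F \<longlongrightarrow> 0) at_top"
      unfolding F_def by (rule tendsto_mult_right_zero)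
  qed auto
  finally show ?thesis by (simp add: F_def)
qed

lemma prob_marginal_prior_centered_le:
  assumes g: "g \<in> density_class M" and "M > 0" "t > 0" "n \<ge> 3"
  shows "measure (marginal_prior g n) (shifted_ball n (\<lambda>_. 0) t) \<le> 9 * M * (t\<^sup>2 / real n)"
proof -
  let ?B = "shifted_ball n (\<lambda>_. 0) t"
  interpret prob_space "marginal_prior g n" using g by (rule prob_space_marginal_prior)
  have cond: "emeasure (conditional_law n \<tau>) ?B \<le> ennreal (exp 1) * ennreal ((1 / sqrt (1 + 2 * \<tau> / t\<^sup>2)) ^ n)"
    if "\<tau> > 0" for \<tau>
  proof -
    have pos: "0 < 1 + 2 * (1 / t\<^sup>2) * \<tau>" using that assms by (simp add: add_pos_nonneg)
    have "emeasure (conditional_law n \<tau>) ?B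
      \<le> ennreal (exp (1 / t\<^sup>2 * t\<^sup>2) * ((1 / sqrt (1 + 2 * (1 / t\<^sup>2) * \<tau>)) ^ n
         * exp (- (1 / t\<^sup>2) * (L2_set (\<lambda>_. 0) {..<n})\<^sup>2 / (1 + 2 * (1 / t\<^sup>2) * \<tau>))))"
      by (rule emeasure_conditional_law_le_exp[OF that pos shifted_ball_sets])
         (use assms in \<open>auto simp: shifted_ball_def intro!: divide_right_mono L2_set_less_imp_power2_le\<close>)
    then show ?thesis using assms that by (simp add: L2_set_def flip: ennreal_mult)
  qed
  have "emeasure (marginal_prior g n) ?B
      = (\<integral>\<^sup>+\<tau>. ennreal (g \<tau>) * emeasure (conditional_law n \<tau>) ?B * indicator {0<..} \<tau> \<partial>lborel)"
    by (rule emeasure_marginal_prior_lborel[OF g shifted_ball_sets])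
  \<comment> \<open>The upper bound \<open>g \<tau> \<le> M\<close> replaces the variance law by M
    times Lebesgue measure.\<close>
  also have "\<dots> \<le> (\<integral>\<^sup>+\<tau>. ennreal (M * exp 1) *
      (ennreal ((1 / sqrt (1 + 2 * \<tau> / t\<^sup>2)) ^ n) * indicator {0..} \<tau>) \<partial>lborel)"
  proof (intro nn_integral_mono)
    fix \<tau>
    show "ennreal (g \<tau>) * emeasure (conditional_law n \<tau>) ?B * indicator {0<..} \<tau>
      \<le> ennreal (M * exp 1) * (ennreal ((1 / sqrt (1 + 2 * \<tau> / t\<^sup>2)) ^ n) * indicator {0..} \<tau>)"
    proof (cases "\<tau> > 0")
      case True
      then have "g \<tau> \<le> M" using g by (simp add: density_class_def)
      then have "ennreal (g \<tau>) * emeasure (conditional_law n \<tau>) ?B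
          \<le> ennreal M * (ennreal (exp 1) * ennreal ((1 / sqrt (1 + 2 * \<tau> / t\<^sup>2)) ^ n))"
        by (intro mult_mono cond[OF True] ennreal_leI) auto
      then show ?thesis using True assms by (simp add: ennreal_mult' mult.assoc)
    qed auto
  qed
  also have "\<dots> = ennreal (M * exp 1) *
      (\<integral>\<^sup>+\<tau>. ennreal ((1 / sqrt (1 + 2 * \<tau> / t\<^sup>2)) ^ n) * indicator {0..} \<tau> \<partial>lborel)"
    by (rule nn_integral_cmult) measurable
  also have "\<dots> = ennreal (M * exp 1 * (t\<^sup>2 / (real n - 2)))"
    using assms by (subst nn_integral_rational_decay) (auto simp flip: ennreal_mult')
  finally have "prob ?B \<le> M * exp 1 * (t\<^sup>2 / (real n - 2))"
    using assms by (simp add: emeasure_eq_measure ennreal_le_iff)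
  \<comment> \<open>The constant 9 arises from e \<le> 3 and from n \<le> 3(n - 2), valid for n
    \<ge> 3.\<close>
  also have "\<dots> \<le> M * 3 * (3 * (t\<^sup>2 / real n))"
  proof (intro mult_mono)
    have "t\<^sup>2 * real n \<le> t\<^sup>2 * (3 * (real n - 2))"
      using assms by (intro mult_left_mono) auto
    then show "t\<^sup>2 / (real n - 2) \<le> 3 * (t\<^sup>2 / real n)"
      using assms by (simp add: field_simps)
  qed (use assms exp_le in auto)
  finally show ?thesis by simp
qed

text \<open>For small \<tau> the complement of the ball is a large-deviation event, which the
  Chernoff bound with negative k makes at most 1/2.\<close>

lemma prob_marginal_prior_centered_ge:
  assumes g: "g \<in> density_class M" and "M > 0" "t > 0" "n \<ge> 2" "t\<^sup>2 \<le> real n"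
  shows "1 / (8 * M) * (t\<^sup>2 / real n) \<le> measure (marginal_prior g n) (shifted_ball n (\<lambda>_. 0) t)"
proof -
  let ?B = "shifted_ball n (\<lambda>_. 0) t"
  let ?S = "space (\<Pi>\<^sub>M j\<in>{..<n}. borel :: real measure)"
  interpret prob_space "marginal_prior g n" using g by (rule prob_space_marginal_prior)
  have cond: "ennreal (1 / 2) \<le> emeasure (conditional_law n \<tau>) ?B"
    if \<tau>: "0 < \<tau>" "\<tau> < t\<^sup>2 / (4 * real n)" for \<tau>
  proof -
    interpret cond: prob_space "conditional_law n \<tau>" using \<tau>(1) by (rule prob_space_conditional_law)
    \<comment> \<open>This k gives u = 1/2, safely positive, at the price of a factor
      \<open>sqrt 2 ^ n\<close>.\<close>
    let ?k = "- (1 / (4 * \<tau>))"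
    have u: "1 + 2 * ?k * \<tau> = 1 / 2" using \<tau> by (simp add: field_simps)
    have "emeasure (conditional_law n \<tau>) (?S - ?B)
      \<le> ennreal (exp (?k * t\<^sup>2) * ((1 / sqrt (1 + 2 * ?k * \<tau>)) ^ n
         * exp (- ?k * (L2_set (\<lambda>_. 0) {..<n})\<^sup>2 / (1 + 2 * ?k * \<tau>))))"
      by (rule emeasure_conditional_law_le_exp[OF \<tau>(1) _ sets.compl_sets[OF shifted_ball_sets]])
         (use \<tau> assms in \<open>auto simp: u shifted_ball_def intro!: divide_right_mono power_mono\<close>)
    also have "exp (?k * t\<^sup>2) * ((1 / sqrt (1 + 2 * ?k * \<tau>)) ^ n
         * exp (- ?k * (L2_set (\<lambda>_. 0) {..<n})\<^sup>2 / (1 + 2 * ?k * \<tau>)))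
         = exp (?k * t\<^sup>2) * sqrt 2 ^ n"
      unfolding u by (simp add: L2_set_def real_sqrt_divide)
    also have "\<dots> \<le> (1 / 2) ^ n * sqrt 2 ^ n"
    proof (rule mult_right_mono)
      \<comment> \<open>Here \<tau> < t^2/(4n) enters: the exponential is at most exp(-n) \<le>
        2^(-n), which beats \<open>sqrt 2 ^ n\<close>. What remains is 2^(-n/2), at most 1/2 because
        n \<ge> 2.\<close>
      have "?k * t\<^sup>2 \<le> - real n" using \<tau> assms by (simp add: field_simps)
      then have "exp (?k * t\<^sup>2) \<le> exp (- 1) ^ n" by (simp flip: exp_of_nat_mult)
      also have "exp (- 1) \<le> (1 / 2 :: real)"
        using exp_ge_add_one_self[of 1] by (simp add: exp_minus field_simps)
      then have "exp (- 1) ^ n \<le> (1 / 2 :: real) ^ n" by (intro power_mono) auto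
      finally show "exp (?k * t\<^sup>2) \<le> (1 / 2) ^ n" .
    qed simp
    also have "\<dots> = (sqrt 2 / 2) ^ n" by (simp flip: power_mult_distrib)
    also have "\<dots> \<le> (sqrt 2 / 2) ^ 2"
      using assms by (intro power_decreasing) (auto simp: real_le_lsqrt)
    also have "\<dots> = 1 / 2" by (simp add: power_divide)
    finally have "ennreal (cond.prob (?S - ?B)) \<le> ennreal (1 / 2)"
      by (simp only: cond.emeasure_eq_measure ennreal_leI)
    then have "cond.prob (?S - ?B) \<le> 1 / 2" by (subst (asm) ennreal_le_iff) auto
    moreover have "cond.prob (?S - ?B) = 1 - cond.prob ?B"
      using cond.prob_compl[of ?B] by (simp add: sets_conditional_law space_conditional_law)
    ultimately have "1 / 2 \<le> cond.prob ?B" by simp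
    then show ?thesis unfolding cond.emeasure_eq_measure by (rule ennreal_leI)
  qed
  \<comment> \<open>Interval length t^2/(4n) times conditional probability 1/2 gives the constant
    1/(8M); the hypothesis on t^2 keeps the interval below 1.\<close>
  have "ennreal ((t\<^sup>2 / (4 * real n) - 0) / M * (1 / 2)) \<le> emeasure (marginal_prior g n) ?B"
    by (rule emeasure_marginal_prior_ge[OF g \<open>M > 0\<close> shifted_ball_sets _ _ _ _ cond])
       (use assms in \<open>auto simp: field_simps\<close>)
  then show ?thesis using assms by (simp add: emeasure_eq_measure mult.commute mult.left_commute)
qed

section \<open>Shifted balls: upper and lower bounds\<close>

lemma prob_marginal_prior_shifted_le:
  assumes g: "g \<in> density_class M" and "t > 0" and r: "L2_set b {..<n} > 0"
  shows "measure (marginal_prior g n) (shifted_ball n b t) \<le> (t / L2_set b {..<n}) ^ n"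
proof -
  define r where "r = L2_set b {..<n}"
  have rpos: "r > 0" using r by (simp add: r_def)
  interpret prob_space "marginal_prior g n" using g by (rule prob_space_marginal_prior)
  have "emeasure (marginal_prior g n) (shifted_ball n b t) \<le> ennreal ((t / r) ^ n)"
  proof (rule emeasure_marginal_prior_le[OF g shifted_ball_sets])
    fix \<tau> :: real assume \<tau>: "\<tau> > 0"
    define k where "k = real n / (2 * t\<^sup>2)"
    define u where "u = 1 + 2 * k * \<tau>"
    have k: "k \<ge> 0" by (simp add: k_def)
    have u: "u > 0" using k \<tau> by (simp add: u_def add_pos_nonneg)
    \<comment> \<open>In terms of w the n-th root of the Chernoff bound is (t/r) * sqrt w * exp((1 -
      w)/2), so \<tau> enters only through w, and the last two factors have product at most 1 for
      every w > 0.\<close>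
    define w where "w = r\<^sup>2 / (t\<^sup>2 * u)"
    have wpos: "w > 0" using rpos u assms by (simp add: w_def)
    have "emeasure (conditional_law n \<tau>) (shifted_ball n b t)
      \<le> ennreal (exp (k * t\<^sup>2) * ((1 / sqrt u) ^ n * exp (- k * r\<^sup>2 / u)))"
      unfolding u_def r_def
      by (rule emeasure_conditional_law_le_exp[OF \<tau> _ shifted_ball_sets])
         (use k u assms in \<open>auto simp: u_def shifted_ball_def intro!: mult_left_mono L2_set_less_imp_power2_le\<close>)
    also have "exp (k * t\<^sup>2) * ((1 / sqrt u) ^ n * exp (- k * r\<^sup>2 / u))
        = (1 / sqrt u) ^ n * exp (k * t\<^sup>2 + - k * r\<^sup>2 / u)"
      by (simp only: exp_add mult_ac)
    also have "k * t\<^sup>2 + - k * r\<^sup>2 / u = real n * ((1 - w) / 2)"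
      using u assms by (simp add: k_def w_def field_simps)
    also have "(1 / sqrt u) ^ n * exp (real n * ((1 - w) / 2)) = (1 / sqrt u * exp ((1 - w) / 2)) ^ n"
      by (simp only: exp_of_nat_mult power_mult_distrib)
    also have "\<dots> \<le> (t / r) ^ n"
    proof (rule power_mono)
      have "w \<le> exp (w - 1)" using exp_ge_add_one_self[of "w - 1"] by simp
      then have "sqrt w \<le> sqrt (exp ((w - 1) / 2 + (w - 1) / 2))" by simp
      also have "\<dots> = exp ((w - 1) / 2)" unfolding exp_add by simp
      finally have "sqrt w * exp ((1 - w) / 2) \<le> exp ((w - 1) / 2) * exp ((1 - w) / 2)"
        by (intro mult_right_mono) auto
      also have "\<dots> = 1" by (simp flip: exp_add add: diff_divide_distrib)
      finally have *: "sqrt w * exp ((1 - w) / 2) \<le> 1" .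
      have "sqrt w = r / (t * sqrt u)"
        using rpos u assms by (simp add: w_def real_sqrt_divide real_sqrt_mult)
      then have "1 / sqrt u = t / r * sqrt w" using rpos u assms by simp
      then have "1 / sqrt u * exp ((1 - w) / 2) = t / r * (sqrt w * exp ((1 - w) / 2))" by simp
      also have "\<dots> \<le> t / r * 1" using * rpos assms by (intro mult_left_mono) auto
      finally show "1 / sqrt u * exp ((1 - w) / 2) \<le> t / r" by simp
    qed (use u in auto)
    finally show "emeasure (conditional_law n \<tau>) (shifted_ball n b t) \<le> ennreal ((t / r) ^ n)"
      by (simp add: ennreal_leI)
  qed
  then show ?thesis using rpos assms by (simp add: emeasure_eq_measure r_def)
qed

text \<open>On the interval x^2 \<le> 2(b^2 + h^2), by the parallelogram law for b and x - b. The 2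
  cancels against the one in the normal density, so these exponents add up neatly over
  coordinates.\<close>

lemma emeasure_centered_normal_interval_ge:
  assumes "\<tau> > 0" "h > 0"
  shows "ennreal (2 * h / sqrt (2 * pi * \<tau>) * exp (- (b\<^sup>2 + h\<^sup>2) / \<tau>))
    \<le> emeasure (centered_normal \<tau>) {b - h<..<b + h}"
proof -
  define d where "d = 1 / sqrt (2 * pi * \<tau>) * exp (- (b\<^sup>2 + h\<^sup>2) / \<tau>)"
  have d: "d \<ge> 0" by (simp add: d_def assms less_imp_le)
  have le: "d \<le> normal_density 0 (sqrt \<tau>) x" if x: "b - h < x" "x < b + h" for x
  proof -
    have "(x - b)\<^sup>2 \<le> h\<^sup>2" using x by (intro power2_le_iff_abs_le[THEN iffD2]) auto
    then have "2 * b\<^sup>2 + 2 * (x - b)\<^sup>2 - (x - 2 * b)\<^sup>2 \<le> 2 * b\<^sup>2 + 2 * h\<^sup>2 - 0"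
      by (intro diff_mono add_left_mono mult_left_mono) auto
    moreover have "x\<^sup>2 = 2 * b\<^sup>2 + 2 * (x - b)\<^sup>2 - (x - 2 * b)\<^sup>2"
      by (simp add: power2_eq_square algebra_simps)
    ultimately have "x\<^sup>2 \<le> 2 * (b\<^sup>2 + h\<^sup>2)" by simp
    then have "x\<^sup>2 / (2 * \<tau>) \<le> 2 * (b\<^sup>2 + h\<^sup>2) / (2 * \<tau>)"
      using assms by (intro divide_right_mono) auto
    also have "\<dots> = (b\<^sup>2 + h\<^sup>2) / \<tau>"
      by (rule mult_divide_mult_cancel_left) simp
    finally have "- (b\<^sup>2 + h\<^sup>2) / \<tau> \<le> - x\<^sup>2 / (2 * \<tau>)"
      unfolding minus_divide_left[symmetric] by simp
    then show ?thesis unfolding d_def normal_density_def using assms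
      by (auto intro!: mult_left_mono simp: divide_right_mono)
  qed
  have "ennreal (2 * h / sqrt (2 * pi * \<tau>) * exp (- (b\<^sup>2 + h\<^sup>2) / \<tau>)) = ennreal d * ennreal (2 * h)"
    using d assms by (simp add: d_def flip: ennreal_mult')
  also have "\<dots> = (\<integral>\<^sup>+x. ennreal d * indicator {b - h<..<b + h} x \<partial>lborel)"
    using assms by (subst nn_integral_cmult_indicator) auto
  also have "\<dots> \<le> (\<integral>\<^sup>+x. ennreal (normal_density 0 (sqrt \<tau>) x) * indicator {b - h<..<b + h} x \<partial>lborel)"
    by (intro nn_integral_mono) (auto split: split_indicator intro!: ennreal_leI le)
  also have "\<dots> = emeasure (centered_normal \<tau>) {b - h<..<b + h}"
    by (subst emeasure_density) auto
  finally show ?thesis .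
qed

text \<open>The inscribed cube is a box, so its probability is a product; n h^2 = t^2 reassembles
  the exponents into norms.\<close>

lemma emeasure_conditional_law_ball_ge:
  assumes "\<tau> > 0" "t > 0" "n > 0"
  shows "ennreal ((2 * (t / sqrt n) / sqrt (2 * pi * \<tau>)) ^ n * exp (- ((L2_set b {..<n})\<^sup>2 + t\<^sup>2) / \<tau>))
    \<le> emeasure (conditional_law n \<tau>) (shifted_ball n b t)"
proof -
  define h where "h = t / sqrt n"
  have h: "h > 0" "real n * h\<^sup>2 = t\<^sup>2" using assms by (simp_all add: h_def power_divide)
  have sub: "Pi\<^sub>E {..<n} (\<lambda>j. {b j - h<..<b j + h}) \<subseteq> shifted_ball n b t"
  proof
    fix x assume x: "x \<in> Pi\<^sub>E {..<n} (\<lambda>j. {b j - h<..<b j + h})"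
    have "(x j - b j)\<^sup>2 < h\<^sup>2" if "j < n" for j
    proof -
      have "x j \<in> {b j - h<..<b j + h}" using PiE_mem[OF x, of j] that by simp
      then have "\<bar>x j - b j\<bar> < h" by auto
      then have "\<bar>x j - b j\<bar>\<^sup>2 < h\<^sup>2" by (intro power_strict_mono) auto
      then show ?thesis by simp
    qed
    then have "(\<Sum>j<n. (x j - b j)\<^sup>2) < (\<Sum>j<n. h\<^sup>2)"
      using assms by (intro sum_strict_mono) auto
    then have "(\<Sum>j<n. (x j - b j)\<^sup>2) < t\<^sup>2" by (simp add: h)
    then have "L2_set (\<lambda>j. x j - b j) {..<n} < t"
      unfolding L2_set_def using assms by (simp add: real_less_lsqrt)
    then show "x \<in> shifted_ball n b t"
      using x by (auto simp: shifted_ball_def space_PiM)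
  qed
  have "(\<Sum>j<n. - ((b j)\<^sup>2 + h\<^sup>2) / \<tau>) = - ((L2_set b {..<n})\<^sup>2 + t\<^sup>2) / \<tau>"
    unfolding sum_divide_distrib[symmetric] sum_negf sum.distrib by (simp add: L2_set_def sum_nonneg h)
  then have "(2 * h / sqrt (2 * pi * \<tau>)) ^ n * exp (- ((L2_set b {..<n})\<^sup>2 + t\<^sup>2) / \<tau>)
     = (\<Prod>j<n. 2 * h / sqrt (2 * pi * \<tau>) * exp (- ((b j)\<^sup>2 + h\<^sup>2) / \<tau>))"
    unfolding prod.distrib by (simp flip: exp_sum)
  also have "ennreal \<dots> = (\<Prod>j<n. ennreal (2 * h / sqrt (2 * pi * \<tau>) * exp (- ((b j)\<^sup>2 + h\<^sup>2) / \<tau>)))"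
    using assms h by (intro prod_ennreal[symmetric]) auto
  also have "\<dots> \<le> (\<Prod>j<n. emeasure (centered_normal \<tau>) {b j - h<..<b j + h})"
    by (intro prod_mono_ennreal emeasure_centered_normal_interval_ge assms h)
  also have "\<dots> = emeasure (conditional_law n \<tau>) (Pi\<^sub>E {..<n} (\<lambda>j. {b j - h<..<b j + h}))"
    using assms by (subst emeasure_conditional_law_PiE) auto
  also have "\<dots> \<le> emeasure (conditional_law n \<tau>) (shifted_ball n b t)"
    by (intro emeasure_mono sub) (simp add: sets_conditional_law)
  finally show ?thesis by (simp add: h_def)
qed

text \<open>For r^2/(2n) < \<tau> < r^2/n, the scale of \<tau> natural for a vector of norm r, the
  cube bound loses \<open>(1 / a) ^ (2 * n)\<close> through its side length and
  \<open>(1 / a) ^ (3 * n)\<close> through the exponential. The prefactor is the length of this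
  interval divided by M.\<close>

lemma prob_marginal_prior_shifted_ge:
  fixes b :: "nat \<Rightarrow> real" and n :: nat and t :: real
  defines "r \<equiv> L2_set b {..<n}"
  defines "a \<equiv> r / (sqrt 2 * t)"
  assumes g: "g \<in> density_class M" and "M > 0" "t > 0" "n > 0"
    and tr: "4 * t < r" and rn: "r\<^sup>2 \<le> real n"
  shows "r\<^sup>2 / (2 * real n * M) * (1 / a) ^ (5 * n) \<le> measure (marginal_prior g n) (shifted_ball n b t)"
proof -
  interpret prob_space "marginal_prior g n" using g by (rule prob_space_marginal_prior)
  have r: "r > 0" using tr \<open>t > 0\<close> by simp
  then have a: "a > 0" using \<open>t > 0\<close> by (simp add: a_def)
  have r_eq: "r = sqrt 2 * (a * t)" using \<open>t > 0\<close> by (simp add: a_def)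
  have a_ge: "a \<ge> 2 * sqrt 2"
  proof -
    have "2 * sqrt 2 * (sqrt 2 * t) = 2 * (sqrt 2 * sqrt 2) * t" by (simp only: mult_ac)
    also have "\<dots> = 4 * t" by simp
    finally have "2 * sqrt 2 * (sqrt 2 * t) \<le> r" using tr by linarith
    then show ?thesis using \<open>t > 0\<close> by (simp add: a_def pos_le_divide_eq)
  qed
  \<comment> \<open>The number 2.8 separates e from 2 sqrt 2, so powers of e can be absorbed into
    powers of \<open>a\<close>.\<close>
  have "2 * sqrt 2 \<ge> (2.8 :: real)"
    using real_le_rsqrt[of "1.4" 2] by (simp add: power2_eq_square)
  then have a28: "a \<ge> 2.8" using a_ge by simp
  have e_le: "exp 1 \<le> (2.8 :: real)" using e_less_272 by simp
  have cond: "ennreal ((1 / a) ^ (5 * n)) \<le> emeasure (conditional_law n \<tau>) (shifted_ball n b t)"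
    if \<tau>: "r\<^sup>2 / (2 * real n) < \<tau>" "\<tau> < r\<^sup>2 / real n" for \<tau>
  proof -
    have "0 < r\<^sup>2 / (2 * real n)" using r \<open>n > 0\<close> by simp
    with \<tau> have \<tau>pos: "\<tau> > 0" by linarith
    have width: "(1 / a) ^ 2 \<le> 2 * (t / sqrt n) / sqrt (2 * pi * \<tau>)"
    proof -
      \<comment> \<open>With \<pi> < 4 and \<tau> < r^2/n the ratio in \<open>width\<close> is at
        least 1/(2a), hence at least 1/a^2 because a \<ge> 2.\<close>
      have "2 * pi * \<tau> \<le> 8 * (r\<^sup>2 / real n)"
        using \<tau> \<tau>pos pi_less_4 by (intro mult_mono) auto
      then have "sqrt (2 * pi * \<tau>) \<le> sqrt (8 * (r\<^sup>2 / real n))" by simp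
      also have "\<dots> = 2 * sqrt 2 * (r / sqrt n)"
        using r real_sqrt_mult[of 4 2] by (simp add: real_sqrt_mult real_sqrt_divide)
      also have "\<dots> = 2 * (sqrt 2 * sqrt 2) * a * (t / sqrt n)"
        by (simp only: r_eq times_divide_eq_right mult_ac)
      also have "\<dots> = 4 * a * (t / sqrt n)" by simp
      finally have "2 * (t / sqrt n) / (4 * a * (t / sqrt n)) \<le> 2 * (t / sqrt n) / sqrt (2 * pi * \<tau>)"
        using \<tau>pos \<open>t > 0\<close> a \<open>n > 0\<close> by (intro divide_left_mono) auto
      moreover have "2 * (t / sqrt n) / (4 * a * (t / sqrt n)) = 1 / (2 * a)"
        using a \<open>t > 0\<close> \<open>n > 0\<close> by (simp add: field_simps)
      moreover have "(1 / a) ^ 2 \<le> 1 / (2 * a)"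
        using a28 by (simp add: power2_eq_square divide_simps)
      ultimately show ?thesis by linarith
    qed
    have expo: "(1 / a) ^ (3 * n) \<le> exp (- (r\<^sup>2 + t\<^sup>2) / \<tau>)"
    proof -
      have "exp 1 ^ (3 * n) \<le> a ^ (3 * n)"
        using e_le a28 by (intro power_mono) auto
      then have "(1 / a) ^ (3 * n) \<le> 1 / exp 1 ^ (3 * n)"
        using a by (simp add: power_divide frac_le)
      also have "\<dots> = exp (- (3 * real n))"
        by (simp add: exp_minus divide_inverse flip: exp_of_nat_mult)
      also have "- (3 * real n) \<le> - (r\<^sup>2 + t\<^sup>2) / \<tau>"
      proof -
        \<comment> \<open>From 4t < r, r^2 + t^2 is at most 3/2 of r^2, and \<tau> > r^2/(2n) turns
          this into the exponent 3n.\<close>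
        have "(4 * t)\<^sup>2 \<le> r\<^sup>2" using tr \<open>t > 0\<close> by (intro power_mono) auto
        then have "16 * t\<^sup>2 \<le> r\<^sup>2" by (simp add: power_mult_distrib)
        have "2 * (y + x) \<le> 3 * y" if "0 \<le> x" "16 * x \<le> y" for x y :: real
          using that by simp
        from this[OF zero_le_power2 \<open>16 * t\<^sup>2 \<le> r\<^sup>2\<close>] have "2 * (r\<^sup>2 + t\<^sup>2) \<le> 3 * r\<^sup>2" .
        also have "r\<^sup>2 < \<tau> * (2 * real n)" using \<tau> \<open>n > 0\<close> by (simp add: pos_divide_less_eq)
        finally have "r\<^sup>2 + t\<^sup>2 \<le> 3 * real n * \<tau>" by (simp add: mult_ac)
        then have "(r\<^sup>2 + t\<^sup>2) / \<tau> \<le> 3 * real n" using \<tau>pos by (simp only: pos_divide_le_eq)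
        then show ?thesis unfolding minus_divide_left[symmetric] by (simp only: neg_le_iff_le)
      qed
      finally show ?thesis by simp
    qed
    have "(1 / a) ^ (5 * n) = ((1 / a) ^ 2) ^ n * (1 / a) ^ (3 * n)"
      by (simp flip: power_mult power_add)
    also have "\<dots> \<le> (2 * (t / sqrt n) / sqrt (2 * pi * \<tau>)) ^ n * exp (- (r\<^sup>2 + t\<^sup>2) / \<tau>)"
      using a \<tau>pos \<open>t > 0\<close> by (intro mult_mono power_mono width expo) auto
    finally have "ennreal ((1 / a) ^ (5 * n))
        \<le> ennreal ((2 * (t / sqrt n) / sqrt (2 * pi * \<tau>)) ^ n * exp (- (r\<^sup>2 + t\<^sup>2) / \<tau>))"
      by (rule ennreal_leI)
    also have "\<dots> \<le> emeasure (conditional_law n \<tau>) (shifted_ball n b t)"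
      unfolding r_def using \<tau>pos \<open>t > 0\<close> \<open>n > 0\<close> by (rule emeasure_conditional_law_ball_ge)
    finally show ?thesis .
  qed
  have half: "r\<^sup>2 / real n - r\<^sup>2 / (2 * real n) = r\<^sup>2 / (2 * real n)"
    using \<open>n > 0\<close> by (simp add: field_simps)
  have "ennreal ((r\<^sup>2 / real n - r\<^sup>2 / (2 * real n)) / M * (1 / a) ^ (5 * n))
      \<le> emeasure (marginal_prior g n) (shifted_ball n b t)"
    by (rule emeasure_marginal_prior_ge[OF g \<open>M > 0\<close> shifted_ball_sets _ _ _ _ cond])
       (use assms a in \<open>auto simp: divide_left_mono frac_le\<close>)
  then show ?thesis unfolding half by (simp add: emeasure_eq_measure)
qed

section \<open>Assembly for large n\<close>

lemma prob_marginal_prior_eq_measure: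
  "\<P>(\<theta> in marginal_prior g n. L2_set (\<lambda>j. \<theta> j - b j) {..<n} < t)
    = measure (marginal_prior g n) (shifted_ball n b t)"
  by (simp add: shifted_ball_def space_marginal_prior)

lemma eventually_small_ball_bounds:
  fixes \<theta>0 :: "nat \<Rightarrow> nat \<Rightarrow> real"
  assumes M: "M > 0" and \<delta>: "\<delta> \<in> {0<..<1::real}" and g: "g \<in> density_class M"
    and o: "(\<lambda>n. L2_set (\<theta>0 n) {..<n}) \<in> o(\<lambda>n. sqrt (real n))"
  shows "\<forall>\<^sub>F n in sequentially.
    let t = real n powr (\<delta> / 2);
        a = L2_set (\<theta>0 n) {..<n} / (sqrt 2 * t)
    in 1 / (8 * M) * exp (- (1 - \<delta>) * ln (real n))
         \<le> \<P>(\<theta> in marginal_prior g n. L2_set \<theta> {..<n} < t) \<and>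
       \<P>(\<theta> in marginal_prior g n. L2_set \<theta> {..<n} < t)
         \<le> 9 * M * exp (- (1 - \<delta>) * ln (real n)) \<and>
       (1 / 4 * L2_set (\<theta>0 n) {..<n} > t \<longrightarrow>
         a > 1 \<and>
         exp (- 6 * real n * ln a)
           \<le> \<P>(\<theta> in marginal_prior g n. L2_set (\<lambda>j. \<theta> j - \<theta>0 n j) {..<n} < t) \<and>
         \<P>(\<theta> in marginal_prior g n. L2_set (\<lambda>j. \<theta> j - \<theta>0 n j) {..<n} < t)
           \<le> exp (- 1 * real n * ln a))"
proof -
  \<comment> \<open>The growth condition enters through r^2 \<le> n, which keeps the relevant
    variances below 1, where \<open>g\<close> is bounded from below.\<close>
  have ev1: "\<forall>\<^sub>F n in sequentially. L2_set (\<theta>0 n) {..<n} \<le> sqrt (real n)"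
    using landau_o.smallD[OF o, of 1] by (simp add: abs_of_nonneg)
  \<comment> \<open>Prepares for absorbing the prefactor r^2/(2nM) of the shifted lower bound into
    one more power \<open>(1 / a) ^ n\<close>. This raises the exponent from 5n to 6n.\<close>
  have "(\<lambda>n. real n * M * (1 / 2) ^ n) \<longlonglongrightarrow> 0" by real_asymp
  then have ev2: "\<forall>\<^sub>F n in sequentially. real n * M * (1 / 2) ^ n < 8"
    by (rule order_tendstoD) simp
  show ?thesis
    using ev1 ev2 eventually_ge_at_top[of 3]
  proof eventually_elim
    case (elim n)
    define t where "t = real n powr (\<delta> / 2)"
    define r where "r = L2_set (\<theta>0 n) {..<n}"
    define a where "a = r / (sqrt 2 * t)"
    have n: "real n \<ge> 3" using elim by simp
    have t1: "t \<ge> 1" unfolding t_def using n \<delta> by (intro ge_one_powr_ge_zero) auto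
    have t2: "t\<^sup>2 = real n powr \<delta>"
      using n by (simp add: t_def power2_eq_square flip: powr_add)
    also have "\<dots> \<le> real n powr 1" using n \<delta> by (intro powr_mono) auto
    finally have t2n: "t\<^sup>2 \<le> real n" using n by simp
    have rate: "exp (- (1 - \<delta>) * ln (real n)) = t\<^sup>2 / real n"
    proof -
      have "exp (- (1 - \<delta>) * ln (real n)) = real n powr (\<delta> - 1)"
        using n by (simp add: powr_def)
      then show ?thesis unfolding t2 using n by (simp add: powr_diff)
    qed
    have centered: "\<P>(\<theta> in marginal_prior g n. L2_set \<theta> {..<n} < t)
        = measure (marginal_prior g n) (shifted_ball n (\<lambda>_. 0) t)"
      using prob_marginal_prior_eq_measure[of g n "\<lambda>_. 0" t] by simp
    have shifted: "a > 1 \<and>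
        exp (- 6 * real n * ln a) \<le> measure (marginal_prior g n) (shifted_ball n (\<theta>0 n) t) \<and>
        measure (marginal_prior g n) (shifted_ball n (\<theta>0 n) t) \<le> exp (- 1 * real n * ln a)"
      if tr: "4 * t < r"
    proof (intro conjI)
      have r: "r > 0" using tr t1 by simp
      have "2 * (sqrt 2 * t) \<le> 2 * (2 * t)"
        using t1 by (intro mult_left_mono mult_right_mono) (auto simp: real_le_lsqrt)
      then have "2 * (sqrt 2 * t) \<le> r" using tr by linarith
      then have a2: "a \<ge> 2" using t1 by (simp add: a_def pos_le_divide_eq)
      then show "a > 1" by simp
      have exp_ln: "exp (- real k * real n * ln a) = (1 / a) ^ (k * n)" for k
      proof -
        have "exp (- real k * real n * ln a) = exp (real (k * n) * ln (1 / a))"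
          using a2 by (simp add: ln_div)
        then show ?thesis using a2 by (simp only: exp_of_nat_mult) simp
      qed
      have "(1 / a) ^ n \<le> (1 / 2) ^ n" using a2 by (intro power_mono) (auto simp: field_simps)
      then have "real n * M * (1 / a) ^ n \<le> real n * M * (1 / 2) ^ n"
        using M by (intro mult_left_mono) auto
      with elim(2) have "real n * M * (1 / a) ^ n \<le> 8" by linarith
      \<comment> \<open>Since t \<ge> 1, r exceeds 4; the threshold 8 above is half of this
        16.\<close>
      moreover have "16 \<le> r\<^sup>2" using power_mono[of 4 r 2] tr t1 by simp
      ultimately have "2 * (real n * M * (1 / a) ^ n) \<le> r\<^sup>2" by simp
      then have "(1 / a) ^ n \<le> r\<^sup>2 / (2 * real n * M)"
        using n M by (simp add: pos_le_divide_eq mult_ac)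
      then have "(1 / a) ^ n * (1 / a) ^ (5 * n) \<le> r\<^sup>2 / (2 * real n * M) * (1 / a) ^ (5 * n)"
        using a2 by (intro mult_right_mono) auto
      also have "\<dots> \<le> measure (marginal_prior g n) (shifted_ball n (\<theta>0 n) t)"
      proof -
        have "r\<^sup>2 \<le> (sqrt (real n))\<^sup>2"
          using elim r by (intro power_mono) (auto simp: r_def)
        then show ?thesis
          using n t1 tr M unfolding a_def r_def
          by (intro prob_marginal_prior_shifted_ge[OF g]) auto
      qed
      also have "(1 / a) ^ n * (1 / a) ^ (5 * n) = exp (- 6 * real n * ln a)"
        using exp_ln[of 6] by (simp flip: power_add)
      finally show "exp (- 6 * real n * ln a) \<le> measure (marginal_prior g n) (shifted_ball n (\<theta>0 n) t)" .
      have "measure (marginal_prior g n) (shifted_ball n (\<theta>0 n) t) \<le> (t / r) ^ n"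
        unfolding r_def using t1 r by (intro prob_marginal_prior_shifted_le[OF g]) (auto simp: r_def)
      also have "\<dots> \<le> (1 / a) ^ n"
      proof (rule power_mono)
        \<comment> \<open>Since t/r = 1/(sqrt 2 * a), passing to 1/a only gives away a factor sqrt 2
          per coordinate.\<close>
        have "1 * t \<le> sqrt 2 * t" using t1 by (intro mult_right_mono) auto
        then show "t / r \<le> 1 / a" using r by (simp add: a_def divide_right_mono)
      qed (use r t1 in auto)
      also have "\<dots> = exp (- 1 * real n * ln a)" using exp_ln[of 1] by simp
      finally show "measure (marginal_prior g n) (shifted_ball n (\<theta>0 n) t) \<le> exp (- 1 * real n * ln a)" .
    qed
    show ?case
      unfolding Let_def t_def[symmetric] r_def[symmetric] a_def[symmetric] rate centered
        prob_marginal_prior_eq_measure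
      using prob_marginal_prior_centered_ge[OF g M _ _ t2n] prob_marginal_prior_centered_le[OF g M]
        t1 elim shifted
      by simp
  qed
qed

text \<open>The quantifier order records the dependence of the constants: \<open>c2\<close> is
  universal, \<open>C1\<close> and \<open>C2\<close> may depend on \<open>M\<close> only,
  \<open>c1\<close> on \<open>M\<close> and \<delta>, and the threshold for n on all the data. The
  witnesses are 1, 1/(8M), 9M and 6.\<close>

theorem theorem3p3:
  shows "\<exists>c2>0. \<forall>M>0. \<exists>C1>0. \<exists>C2>0. \<forall>\<delta>\<in>{0<..<1::real}. \<exists>c1>0.
    \<forall>g \<in> density_class M. \<forall>\<theta>0 :: nat \<Rightarrow> nat \<Rightarrow> real.
      (\<lambda>n. L2_set (\<theta>0 n) {..<n}) \<in> o(\<lambda>n. sqrt (real n)) \<longrightarrow>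
      (\<forall>\<^sub>F n in sequentially.
        let t = real n powr (\<delta> / 2);
            a = L2_set (\<theta>0 n) {..<n} / (sqrt 2 * t)
        in C1 * exp (- (1 - \<delta>) * ln (real n))
             \<le> \<P>(\<theta> in marginal_prior g n. L2_set \<theta> {..<n} < t) \<and>
           \<P>(\<theta> in marginal_prior g n. L2_set \<theta> {..<n} < t)
             \<le> C2 * exp (- (1 - \<delta>) * ln (real n)) \<and>
           (1 / 4 * L2_set (\<theta>0 n) {..<n} > t \<longrightarrow>
             a > 1 \<and>
             exp (- c1 * real n * ln a)
               \<le> \<P>(\<theta> in marginal_prior g n. L2_set (\<lambda>j. \<theta> j - \<theta>0 n j) {..<n} < t) \<and>
             \<P>(\<theta> in marginal_prior g n. L2_set (\<lambda>j. \<theta> j - \<theta>0 n j) {..<n} < t)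
               \<le> exp (- c2 * real n * ln a)))"
  by (rule exI[of _ 1], rule conjI, simp, intro allI impI,
      rule_tac x = "1 / (8 * M)" in exI, rule conjI, simp,
      rule_tac x = "9 * M" in exI, rule conjI, simp,
      rule ballI, rule exI[of _ 6], rule conjI, simp,
      intro ballI allI impI, rule eventually_small_ball_bounds)

end
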